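(* For any non-trivial connected bipartite graph $G$ and any integer $t\ge 2D(G)+1$, $$\dim_l(P_t\boxtimes G)=\left\lceil\frac{t-1}{D(G)}\right\rceil+1.$$
   Context: $P_t$ is the path on $t$ vertices and $D(G)$ is the diameter of $G$. A set $S$ is a local metric generator for a connected graph $X$ if for every two adjacent vertices $x,y$ there is $s\in S$ with $d_X(s,x)\ne d_X(s,y)$; $\dim_l(X)$ is the minimum cardinality of a local metric generator. The strong product $P_t\boxtimes G$ has vertex set $V(P_t)\times V(G)$, with $(a,b)\sim(c,d)$ iff ($a=c$ and $b\sim d$) or ($b=d$ and $a\sim c$) or ($a\sim c$ and $b\sim d$). *)

theory Defs
  imports
    "Graph_Theory.Pair_Digraph"
    "Graph_Theory.Digraph_Component"
    "Graph_Theory.Shortest_Path"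
begin

text \<open>
  A finite simple graph is a \<^locale>\<open>pair_graph\<close>: a finite vertex set together with a finite,
  symmetric, irreflexive set of arcs, each undirected edge being present as two opposite arcs.
\<close>

text \<open>Only meaningful if \<open>v\<close> is reachable from \<open>u\<close>.\<close>

definition gdist :: "'a pair_pre_digraph \<Rightarrow> 'a \<Rightarrow> 'a \<Rightarrow> nat" where
  "gdist G u v = (LEAST n. \<exists>p. pre_digraph.awalk (with_proj G) u p v \<and> length p = n)"

definition diameter :: "'a pair_pre_digraph \<Rightarrow> nat" where
  "diameter G = Max {gdist G u v | u v. u \<in> pverts G \<and> v \<in> pverts G}"

definition bipartite :: "'a pair_pre_digraph \<Rightarrow> bool" where
  "bipartite G \<longleftrightarrow> (\<exists>A B. A \<union> B = pverts G \<and> A \<inter> B = {} \<and>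
     (\<forall>(x, y) \<in> parcs G. (x \<in> A \<and> y \<in> B) \<or> (x \<in> B \<and> y \<in> A)))"

definition path_graph :: "nat \<Rightarrow> nat pair_pre_digraph" where
  "path_graph t = \<lparr> pverts = {..<t},
     parcs = {(i, j). i < t \<and> j < t \<and> (j = Suc i \<or> i = Suc j)} \<rparr>"

definition strong_product ::
  "'a pair_pre_digraph \<Rightarrow> 'b pair_pre_digraph \<Rightarrow> ('a \<times> 'b) pair_pre_digraph" where
  "strong_product G H = \<lparr> pverts = pverts G \<times> pverts H,
     parcs = {((a, b), (c, d)). (a, b) \<in> pverts G \<times> pverts H \<and> (c, d) \<in> pverts G \<times> pverts H \<and>
       (a = c \<and> (b, d) \<in> parcs H \<or>
        b = d \<and> (a, c) \<in> parcs G \<or>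
        (a, c) \<in> parcs G \<and> (b, d) \<in> parcs H)} \<rparr>"

definition local_metric_generator :: "'a pair_pre_digraph \<Rightarrow> 'a set \<Rightarrow> bool" where
  "local_metric_generator X S \<longleftrightarrow> S \<subseteq> pverts X \<and>
     (\<forall>(x, y) \<in> parcs X. \<exists>s\<in>S. gdist X s x \<noteq> gdist X s y)"

definition local_metric_dim :: "'a pair_pre_digraph \<Rightarrow> nat" where
  "local_metric_dim X = (LEAST k. \<exists>S. local_metric_generator X S \<and> finite S \<and> card S = k)"

text \<open>The distance agrees with the shortest-path distance for unit weights.\<close>

lemma (in pair_wf_digraph) gdist_eq_shortest_path:
  assumes "u \<rightarrow>\<^sup>*\<^bsub>with_proj G\<^esub> v"
  shows "ereal (real (gdist G u v)) = \<mu> (\<lambda>_. 1) u v"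
proof -
  have cost: "awalk_cost (\<lambda>_. 1) p = real (length p)" for p :: "('a \<times> 'a) list"
    by (induction p) auto
  obtain p0 where "awalk u p0 v"
    using assms by (auto simp: reachable_awalk)
  then have "\<exists>n p. awalk u p v \<and> length p = n" by blast
  then have "\<exists>p. awalk u p v \<and> length p = gdist G u v"
    unfolding gdist_def by (rule LeastI_ex)
  then obtain p where p: "awalk u p v" "length p = gdist G u v" by blast
  have le: "gdist G u v \<le> length q" if "awalk u q v" for q
    unfolding gdist_def by (rule Least_le) (use that in blast)
  show ?thesis
    unfolding \<mu>_def
  proof (rule INF_eqI[symmetric])
    show "ereal (real (gdist G u v)) \<le> ereal (awalk_cost (\<lambda>_. 1) q)"
      if "q \<in> {p. awalk u p v}" for q
      using le that by (simp add: cost)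
    show "y \<le> ereal (real (gdist G u v))"
      if "\<And>q. q \<in> {p. awalk u p v} \<Longrightarrow> y \<le> ereal (awalk_cost (\<lambda>_. 1) q)" for y
      using that[of p] p by (simp add: cost)
  qed
qed

lemma pair_graph_path_graph: "pair_graph (path_graph t)"
proof -
  have "finite (parcs (path_graph t))"
    by (rule finite_subset[of _ "{..<t} \<times> {..<t}"]) (auto simp: path_graph_def)
  then show ?thesis
    by unfold_locales (auto simp: path_graph_def symmetric_def intro!: symI)
qed

lemma pair_graph_strong_product:
  assumes "pair_graph G" "pair_graph H"
  shows "pair_graph (strong_product G H)"
proof -
  interpret G: pair_graph G by fact
  interpret H: pair_graph H by fact
  have fin: "finite (pverts G \<times> pverts H)"
    using G.pair_finite_verts H.pair_finite_verts by simp
  have "finite (parcs (strong_product G H))"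
    by (rule finite_subset[of _ "(pverts G \<times> pverts H) \<times> (pverts G \<times> pverts H)"])
       (use fin in \<open>auto simp: strong_product_def\<close>)
  moreover have "sym (parcs G)" "sym (parcs H)"
    using G.pair_sym_arcs H.pair_sym_arcs by (simp_all add: symmetric_def)
  ultimately show ?thesis
    using fin by unfold_locales
      (auto simp: strong_product_def symmetric_def intro!: symI
        dest: symD G.pair_no_loops H.pair_no_loops)
qed

end

theory Submission
  imports Defs
begin

text \<open>
  Write \<open>D\<close> for the diameter of \<open>G\<close>. In the strong product, the distance between \<open>(p, w)\<close> and
  \<open>(i, b)\<close> is the maximum of \<open>\<bar>p - i\<bar>\<close> and the distance of \<open>w\<close> and \<open>b\<close> in \<open>G\<close>.
  Hence \<open>(p, w)\<close> distinguishes the ends of some arc of \<open>G\<close> on layer \<open>i\<close> only if \<open>\<bar>p - i\<bar> < D\<close>.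

  Upper bound: place the two ends of a diametral pair alternately on the layers \<open>0, D, 2D, \<dots>\<close> and on
  the last layer. Two consecutive ones take care of the arcs within the layers between them, and the
  first and the last one of all other arcs.

  Lower bound: on a layer \<open>i\<close> without a generator element, a single element at distance less than \<open>D\<close>
  misses the arcs at its own \<open>G\<close>-coordinate, so there must be two; and if there are exactly two, an arc
  on a geodesic between their \<open>G\<close>-coordinates is missed unless their distances to \<open>i\<close> sum up to at
  most \<open>D\<close>. Counting elements around the layers \<open>0, D, 2D, \<dots>\<close> gives the bound with the floor in
  place of the ceiling, and the condition on the sums excludes equality if \<open>D\<close> does not divide \<open>t - 1\<close>.
\<close>

section \<open>Distances as least exponents of the arc relation\<close>

lemma (in pair_wf_digraph) arc_endsD:
  assumes "(u, v) \<in> parcs G"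
  shows "u \<in> pverts G" "v \<in> pverts G"
  using wellformed[OF assms] by auto

text \<open>Relational powers are easier to split and reverse than arc lists. The condition on
  \<open>u\<close> matters for \<open>n = 0\<close>, where the power is the full identity
  relation.\<close>

lemma (in pair_wf_digraph) awalk_length_iff_relpow:
  "(\<exists>p. awalk u p v \<and> length p = n) \<longleftrightarrow> u \<in> pverts G \<and> (u, v) \<in> parcs G ^^ n"
proof (induction n arbitrary: u)
  case 0
  then show ?case by (auto simp: awalk_Nil_iff)
next
  case (Suc n)
  have "(\<exists>p. awalk u p v \<and> length p = Suc n) \<longleftrightarrow> (\<exists>e p. awalk u (e # p) v \<and> length p = n)"
    unfolding length_Suc_conv by blast
  also have "\<dots> \<longleftrightarrow> (\<exists>x. (u, x) \<in> parcs G \<and> (\<exists>p. awalk x p v \<and> length p = n))"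
    by (simp add: awalk_Cons_iff split_paired_Ex)
  also have "\<dots> \<longleftrightarrow> (\<exists>x. (u, x) \<in> parcs G \<and> x \<in> pverts G \<and> (x, v) \<in> parcs G ^^ n)"
    unfolding Suc.IH ..
  also have "\<dots> \<longleftrightarrow> u \<in> pverts G \<and> (u, v) \<in> parcs G ^^ Suc n"
    using arc_endsD by (auto simp flip: relpow_commute)
  finally show ?case .
qed

lemma (in pair_wf_digraph) gdist_relpow_conv:
  assumes "u \<in> pverts G"
  shows "gdist G u v = (LEAST n. (u, v) \<in> parcs G ^^ n)"
  using assms by (simp add: gdist_def awalk_length_iff_relpow)

lemma (in pair_wf_digraph) gdist_le:
  assumes "u \<in> pverts G" "(u, v) \<in> parcs G ^^ n"
  shows "gdist G u v \<le> n"
  using assms by (simp add: gdist_relpow_conv Least_le)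

text \<open>A potential that grows by at most one along each arc is a lower bound for walk lengths
  from \<open>u\<close>. Stepping back along arcs that lower it ends in \<open>u\<close> and yields
  a walk of length at most \<open>f v\<close>.\<close>

lemma (in pair_wf_digraph) gdist_eqI:
  assumes u: "u \<in> pverts G" and v: "v \<in> pverts G" and zero: "f u = 0"
    and step: "\<And>x y. (x, y) \<in> parcs G \<Longrightarrow> f y \<le> Suc (f x)"
    and pred: "\<And>x. x \<in> pverts G \<Longrightarrow> x \<noteq> u \<Longrightarrow> \<exists>y. (y, x) \<in> parcs G \<and> f y < f x"
  shows "gdist G u v = f v"
proof -
  have low: "f x \<le> n" if "(u, x) \<in> parcs G ^^ n" for n x
    using that
  proof (induction n arbitrary: x)
    case (Suc n)
    then obtain y where y: "(u, y) \<in> parcs G ^^ n" "(y, x) \<in> parcs G"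
      by (auto elim: relpow_Suc_E)
    from Suc.IH[OF y(1)] step[OF y(2)] show ?case by simp
  qed (use zero in auto)
  have up: "\<exists>n \<le> f x. (u, x) \<in> parcs G ^^ n" if "x \<in> pverts G" for x
    using that
  proof (induction "f x" arbitrary: x rule: less_induct)
    case less
    show ?case
    proof (cases "x = u")
      case True
      then show ?thesis by (auto intro!: exI[of _ 0])
    next
      case False
      then obtain y where y: "(y, x) \<in> parcs G" "f y < f x" using pred less.prems by blast
      then obtain n where "n \<le> f y" "(u, y) \<in> parcs G ^^ n"
        using less.hyps arc_endsD by blast
      then show ?thesis using y by (intro exI[of _ "Suc n"]) (auto intro: relpow_Suc_I)
    qed
  qed
  from up[OF v] obtain n where n: "n \<le> f v" "(u, v) \<in> parcs G ^^ n" by blast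
  show ?thesis
    unfolding gdist_relpow_conv[OF u]
    by (rule Least_equality) (use n low[OF n(2)] low in auto)
qed

section \<open>The metric of a connected graph\<close>

locale connected_pair_graph = pair_graph +
  assumes conn: "Digraph_Component.connected (with_proj G)"
begin

abbreviation "d \<equiv> gdist G"

lemma gdist_relpow:
  assumes "u \<in> pverts G" "v \<in> pverts G"
  shows "(u, v) \<in> parcs G ^^ d u v"
proof -
  have "strongly_connected (with_proj G)"
    by (rule symmetric_connected_imp_strongly_connected[OF sym_arcs conn])
  then have "u \<rightarrow>\<^sup>*\<^bsub>with_proj G\<^esub> v"
    using assms by (auto simp: strongly_connected_def)
  then obtain p where "awalk u p v" by (auto simp: reachable_awalk)
  then have "(u, v) \<in> parcs G ^^ length p"
    using awalk_length_iff_relpow by blast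
  then show ?thesis
    unfolding gdist_relpow_conv[OF assms(1)] by (rule LeastI)
qed

lemma gdist_self [simp]: "u \<in> pverts G \<Longrightarrow> d u u = 0"
  using gdist_le[of u u 0] by simp

lemma gdist_eq_0_iff [simp]:
  assumes "u \<in> pverts G" "v \<in> pverts G"
  shows "d u v = 0 \<longleftrightarrow> u = v"
proof
  show "u = v" if "d u v = 0"
    using gdist_relpow[OF assms] unfolding that by simp
qed (use assms in simp)

lemma relpow_sym:
  assumes "(u, v) \<in> parcs G ^^ n"
  shows "(v, u) \<in> parcs G ^^ n"
  using assms
proof (induction n arbitrary: v)
  case (Suc n)
  then obtain w where "(u, w) \<in> parcs G ^^ n" "(w, v) \<in> parcs G"
    by (auto elim: relpow_Suc_E)
  moreover have "sym (parcs G)" using pair_sym_arcs by (simp add: symmetric_def)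
  ultimately show ?case using Suc.IH by (blast intro: relpow_Suc_I2 dest: symD)
qed auto

lemma gdist_commute:
  assumes "u \<in> pverts G" "v \<in> pverts G"
  shows "d u v = d v u"
  using gdist_le[OF assms(1) relpow_sym[OF gdist_relpow[OF assms(2,1)]]]
    gdist_le[OF assms(2) relpow_sym[OF gdist_relpow[OF assms]]] by simp

lemma gdist_triangle:
  assumes "u \<in> pverts G" "v \<in> pverts G" "w \<in> pverts G"
  shows "d u w \<le> d u v + d v w"
  using assms by (intro gdist_le) (auto simp: relpow_add intro: gdist_relpow)

lemma gdist_arc:
  assumes "(u, v) \<in> parcs G"
  shows "d u v = 1"
proof -
  have "u \<in> pverts G" "v \<in> pverts G" "u \<noteq> v"
    using arc_endsD[OF assms] pair_no_loops[OF assms] by auto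
  moreover have "d u v \<le> 1"
    using assms calculation by (intro gdist_le) auto
  ultimately show ?thesis
    by (metis gdist_eq_0_iff le_neq_implies_less less_one)
qed

lemma arc_sym: "(u, v) \<in> parcs G \<Longrightarrow> (v, u) \<in> parcs G"
  using relpow_sym[of u v 1] by simp

lemma gdist_arc_le:
  assumes "(u, v) \<in> parcs G" "w \<in> pverts G"
  shows "d w v \<le> Suc (d w u)"
  using gdist_triangle[of w u v] gdist_arc[OF assms(1)] assms arc_endsD[OF assms(1)] by simp

text \<open>The vertex number \<open>i\<close> of a shortest walk is within \<open>i\<close> of
  \<open>u\<close> and within \<open>d u v - i\<close> of \<open>v\<close>; the triangle inequality
  makes both bounds exact. The lower bound needs an arc whose distances to both ends are
  known.\<close>

lemma geodesic_arc:
  assumes u: "u \<in> pverts G" and v: "v \<in> pverts G" and x: "x < d u v"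
  obtains y z where "(y, z) \<in> parcs G" "d u y = x" "d u z = Suc x"
    "d v y = d u v - x" "d v z = d u v - Suc x"
proof -
  define n where "n = d u v"
  obtain g where g: "g 0 = u" "g n = v" "\<And>i. i < n \<Longrightarrow> (g i, g (Suc i)) \<in> parcs G"
    using gdist_relpow[OF u v] unfolding n_def relpow_fun_conv by auto
  have V: "g i \<in> pverts G" if "i \<le> n" for i
    using that g(1) u arc_endsD(2)[OF g(3)] by (cases i) (auto simp: Suc_le_eq)
  have up: "d u (g i) \<le> i" if "i \<le> n" for i
    using that
  proof (induction i)
    case (Suc i)
    then show ?case using gdist_arc_le[OF g(3)[of i] u] by simp
  qed (use g u in simp)
  have down: "d v (g (n - i)) \<le> i" if "i \<le> n" for i
    using that
  proof (induction i)
    case (Suc i)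
    then show ?case using gdist_arc_le[OF arc_sym[OF g(3)[of "n - Suc i"]] v]
      by (simp add: Suc_diff_Suc)
  qed (use g v in simp)
  have exact: "d u (g i) = i \<and> d v (g i) = n - i" if "i \<le> n" for i
  proof -
    have "n \<le> d u (g i) + d v (g i)"
      using gdist_triangle[OF u V[OF that] v] gdist_commute[OF v V[OF that]] by (simp add: n_def)
    moreover have "d v (g i) \<le> n - i" using down[of "n - i"] that by simp
    ultimately show ?thesis using up[OF that] that by linarith
  qed
  show thesis
    by (rule that[of "g x" "g (Suc x)"]) (use g(3)[of x] exact[of x] exact[of "Suc x"] x in \<open>auto simp: n_def\<close>)
qed

lemma ex_neighbour:
  assumes "u \<in> pverts G" "v \<in> pverts G" "u \<noteq> v"
  obtains w where "(w, v) \<in> parcs G" "Suc (d u w) = d u v"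
proof -
  have pos: "d u v > 0" using assms by (metis gdist_eq_0_iff gr0I)
  then have "d u v - 1 < d u v" by simp
  from geodesic_arc[OF assms(1,2) this] obtain y z where yz: "(y, z) \<in> parcs G"
    "d u y = d u v - 1" "d v z = d u v - Suc (d u v - 1)" by blast
  have "d v z = 0" using yz(3) pos by simp
  then have "z = v" using assms(2) arc_endsD(2)[OF yz(1)] by simp
  then show thesis using that[of y] yz pos by simp
qed

lemma finite_gdists: "finite {d u v | u v. u \<in> pverts G \<and> v \<in> pverts G}"
proof -
  have "{d u v | u v. u \<in> pverts G \<and> v \<in> pverts G} = (\<lambda>(u, v). d u v) ` (pverts G \<times> pverts G)"
    by auto
  then show ?thesis by (simp add: pair_finite_verts)
qed

lemma gdist_le_diameter:
  assumes "u \<in> pverts G" "v \<in> pverts G"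
  shows "d u v \<le> diameter G"
  unfolding diameter_def using assms by (intro Max_ge[OF finite_gdists]) auto

lemma diameter_attained:
  assumes "pverts G \<noteq> {}"
  obtains u v where "u \<in> pverts G" "v \<in> pverts G" "d u v = diameter G"
proof -
  have "diameter G \<in> {d u v | u v. u \<in> pverts G \<and> v \<in> pverts G}"
    unfolding diameter_def using assms by (intro Max_in[OF finite_gdists]) auto
  then show thesis using that by auto
qed

text \<open>The side on which a walk from \<open>w\<close> ends fixes the parity of its length, and
  the ends of an arc lie on opposite sides.\<close>

lemma bipartite_gdist_neq:
  assumes "bipartite G" "(u, v) \<in> parcs G" "w \<in> pverts G"
  shows "d w u \<noteq> d w v"
proof -
  obtain A B where "A \<inter> B = {}"
    and AB: "\<forall>(x, y)\<in>parcs G. (x \<in> A \<and> y \<in> B) \<or> (x \<in> B \<and> y \<in> A)"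
    using assms(1) unfolding bipartite_def by (elim exE conjE)
  then have A: "x \<in> A \<longleftrightarrow> y \<notin> A" if "(x, y) \<in> parcs G" for x y
    using bspec[OF AB that] by auto
  have par: "(w \<in> A \<longleftrightarrow> x \<in> A) \<longleftrightarrow> even n" if "(w, x) \<in> parcs G ^^ n" for n x
    using that
  proof (induction n arbitrary: x)
    case (Suc n)
    then obtain y where "(w, y) \<in> parcs G ^^ n" "(y, x) \<in> parcs G"
      by (auto elim: relpow_Suc_E)
    then show ?case using Suc.IH A by auto
  qed auto
  have "u \<in> pverts G" "v \<in> pverts G" using arc_endsD[OF assms(2)] by auto
  then have "(w \<in> A \<longleftrightarrow> u \<in> A) \<longleftrightarrow> even (d w u)" "(w \<in> A \<longleftrightarrow> v \<in> A) \<longleftrightarrow> even (d w v)"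
    using par[OF gdist_relpow[OF assms(3)]] by simp_all
  then show ?thesis using A[OF assms(2)] by auto
qed

end

section \<open>Counting elements along the layers of the path\<close>

text \<open>
  \<open>L (n + 1) + M n\<close> counts the elements on layers below \<open>(n + 1) * D\<close> and those on layers up to
  \<open>n * D\<close>; it grows by at least two with every \<open>n\<close>. If \<open>card S\<close> is too small, all these estimates are
  sharp up to \<open>q = N div D\<close>, which leaves exactly two elements both around layer \<open>(q - 1) * D\<close> and around layer
  \<open>q * D + 1\<close>, and they are the same two: their distances to these layers sum up to \<open>2 * D + 2\<close>.
\<close>

lemma path_layer_counting:
  fixes p :: "'s \<Rightarrow> nat"
  assumes fin: "finite S" and D: "D > 0" and le: "\<And>s. s \<in> S \<Longrightarrow> p s \<le> N"
    and layer: "\<And>i. i \<le> N \<Longrightarrow> (\<exists>s\<in>S. p s = i) \<or>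
      card {s \<in> S. \<bar>int (p s) - int i\<bar> < int D} \<ge> 2"
    and pair: "\<And>i a b. i \<le> N \<Longrightarrow> \<forall>s\<in>S. p s \<noteq> i \<Longrightarrow>
      {s \<in> S. \<bar>int (p s) - int i\<bar> < int D} = {a, b} \<Longrightarrow> a \<noteq> b \<Longrightarrow>
      \<bar>int (p a) - int i\<bar> + \<bar>int (p b) - int i\<bar> \<le> int D"
  shows "N + D \<le> card S * D"
proof -
  define L where "L n = card {s \<in> S. p s < n * D}" for n
  define M where "M n = card {s \<in> S. p s \<le> n * D}" for n
  \<comment> \<open>This is \<open>M (n - 1)\<close>, written additively so that it vanishes at
    \<open>n = 0\<close> instead of being truncated.\<close>
  define M' where "M' n = card {s \<in> S. p s + D \<le> n * D}" for n
  have M'_Suc: "M' (Suc n) = M n" for n by (simp add: M'_def M_def add.commute)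
  have M'_0: "M' 0 = 0" using D by (simp add: M'_def)
  have LM: "L n \<le> M n" for n
    unfolding L_def M_def by (intro card_mono) (use fin in auto)
  have MLs: "M n \<le> L (Suc n)" for n
    unfolding L_def M_def by (intro card_mono) (use fin D in auto)
  have Mm: "M n \<le> card S" "L n \<le> card S" for n
    unfolding L_def M_def by (intro card_mono; use fin in auto)+
  have window: "card {s \<in> S. \<bar>int (p s) - int (n * D)\<bar> < int D} = L (Suc n) - M' n" for n
  proof -
    have "{s \<in> S. \<bar>int (p s) - int (n * D)\<bar> < int D} =
       {s \<in> S. p s < Suc n * D} - {s \<in> S. p s + D \<le> n * D}"
      by (auto simp: abs_less_iff algebra_simps simp flip: of_nat_mult)
    moreover have "{s \<in> S. p s + D \<le> n * D} \<subseteq> {s \<in> S. p s < Suc n * D}"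
      using D by auto
    ultimately show ?thesis
      unfolding L_def M'_def using fin by (simp add: card_Diff_subset)
  qed
  \<comment> \<open>An element on layer \<open>n * D\<close> is counted by \<open>M n\<close> but
    not by \<open>L n\<close>, and by \<open>L (Suc n)\<close> but not by \<open>M' n\<close>. If
    there is none, the window around this layer contributes two.\<close>
  have step: "L n + M' n + 2 \<le> L (Suc n) + M n" if n: "n * D \<le> N" for n
  proof (cases "\<exists>s\<in>S. p s = n * D")
    case True
    then obtain s where s: "s \<in> S" "p s = n * D" by blast
    have "{s \<in> S. p s < n * D} \<subset> {s \<in> S. p s \<le> n * D}"
    proof (rule psubsetI)
      have "s \<notin> {s \<in> S. p s < n * D}" "s \<in> {s \<in> S. p s \<le> n * D}"
        using s by auto
      then show "{s \<in> S. p s < n * D} \<noteq> {s \<in> S. p s \<le> n * D}" by blast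
    qed auto
    then have "L n < M n"
      unfolding L_def M_def by (intro psubset_card_mono) (use fin in auto)
    moreover have "{s \<in> S. p s + D \<le> n * D} \<subset> {s \<in> S. p s < Suc n * D}"
    proof (rule psubsetI)
      have "s \<notin> {s \<in> S. p s + D \<le> n * D}" "s \<in> {s \<in> S. p s < Suc n * D}"
        using s D by auto
      then show "{s \<in> S. p s + D \<le> n * D} \<noteq> {s \<in> S. p s < Suc n * D}" by blast
    qed (use D in auto)
    then have "M' n < L (Suc n)"
      unfolding L_def M'_def by (intro psubset_card_mono) (use fin in auto)
    ultimately show ?thesis by linarith
  next
    case False
    with layer[OF n] have "L (Suc n) - M' n \<ge> 2" unfolding window by auto
    with LM[of n] show ?thesis by linarith
  qed
  have T: "2 * n + 2 \<le> L (Suc n) + M n" if "n * D \<le> N" for n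
    using that
  proof (induction n)
    case 0
    then show ?case using step[of 0] by simp
  next
    case (Suc n)
    then show ?case using step[of "Suc n"] by (simp add: M'_Suc)
  qed
  define q where "q = N div D"
  have q: "q * D \<le> N" "N < Suc q * D" unfolding q_def using D
    by (simp_all add: dividend_less_div_times add.commute)
  have m: "Suc q \<le> card S"
    using T[OF q(1)] Mm(1)[of q] Mm(2)[of "Suc q"] by linarith
  show ?thesis
  proof (rule ccontr)
    assume neg: "\<not> N + D \<le> card S * D"
    \<comment> \<open>As \<open>N < (q + 1) * D\<close>, having \<open>q + 2\<close> elements would
      suffice for the bound. With exactly \<open>q + 1\<close>, its failure puts layer
      \<open>q * D + 1\<close> on the path.\<close>
    have "card S < Suc (Suc q)"
    proof (rule ccontr)
      assume "\<not> card S < Suc (Suc q)"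
      then have "Suc (Suc q) * D \<le> card S * D" by (intro mult_right_mono) auto
      with q(2) neg show False by simp
    qed
    with m have cS: "card S = Suc q" by simp
    with neg have qN: "Suc (q * D) \<le> N" by simp
    have Mq: "M q = Suc q" and LSq: "L (Suc q) = Suc q"
      using T[OF q(1)] Mm(1)[of q] Mm(2)[of "Suc q"] cS by linarith+
    have "{s \<in> S. p s \<le> q * D} = S"
      using Mq cS fin unfolding M_def by (intro card_subset_eq) auto
    then have top: "p s \<le> q * D" if "s \<in> S" for s using that by blast
    have none: "\<forall>s\<in>S. p s \<noteq> Suc (q * D)" using top by fastforce
    have bound: "L q + M' q \<le> 2 * q"
      using step[OF q(1)] Mq LSq by simp
    define W where "W = {s \<in> S. \<bar>int (p s) - int (Suc (q * D))\<bar> < int D}"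
    define U where "U = {s \<in> S. \<not> p s + D \<le> q * D}"
    have WU: "W \<subseteq> U" unfolding W_def U_def by (auto simp: abs_less_iff simp flip: of_nat_mult of_nat_add)
    have finU: "finite U" using fin unfolding U_def by simp
    have W2: "card W \<ge> 2" using layer[OF qN] none unfolding W_def by auto
    have "S - U = {s \<in> S. p s + D \<le> q * D}" unfolding U_def by auto
    then have cardU: "card U = Suc q - M' q"
      using card_Diff_subset[of U S] card_mono[of S U] fin finU cS unfolding U_def M'_def
      by auto
    have "q \<noteq> 0"
    proof
      assume "q = 0"
      then show False using cardU cS M'_0 W2 card_mono[OF finU WU] by simp
    qed
    then obtain r where r: "q = Suc r" by (cases q) auto
    have rN: "r * D \<le> N" using q(1) r by simp
    \<comment> \<open>\<open>U\<close> consists of the elements above layer \<open>r * D\<close> and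
      contains \<open>W\<close>, so at least two of the \<open>r + 2\<close> elements of
      \<open>S\<close> lie above that layer.\<close>
    have Mr: "M r \<le> r" using cardU W2 card_mono[OF finU WU] r by (simp add: M'_Suc)
    have Lq: "L (Suc r) = Suc (Suc r)" and Mr_eq: "M r = r"
      using T[OF rN] Mr bound r M'_Suc[of r] Mm(2)[of q] cS by auto
    have M'r: "M' r = r"
    proof (cases r)
      case 0
      then show ?thesis using M'_0 by simp
    next
      case (Suc k)
      have "k * D \<le> N" using rN Suc by simp
      from T[OF this] LM[of r] MLs[of k] show ?thesis using Suc Mr_eq by (simp add: M'_Suc)
    qed
    \<comment> \<open>Equal cardinalities show that the layers above \<open>(r - 1) * D\<close> up
      to \<open>r * D\<close> are empty; hence the window \<open>V\<close> around
      \<open>r * D\<close> only sees elements of \<open>U\<close>.\<close>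
    have "{s \<in> S. p s + D \<le> r * D} = {s \<in> S. p s \<le> r * D}"
      using M'r Mr_eq fin unfolding M_def M'_def by (intro card_subset_eq) auto
    then have gap: "p s + D \<le> r * D" if "s \<in> S" "p s \<le> r * D" for s
      using that by blast
    have none_r: "\<forall>s\<in>S. p s \<noteq> r * D" using gap D by fastforce
    have "card U = 2" using cardU r by (simp add: M'_Suc Mr_eq)
    then have "W = U" using W2 WU finU by (metis card_seteq)
    define V where "V = {s \<in> S. \<bar>int (p s) - int (r * D)\<bar> < int D}"
    have "card V = 2" unfolding V_def window Lq M'r by simp
    moreover have "V \<subseteq> U"
    proof
      fix s assume "s \<in> V"
      then have s: "s \<in> S" "\<not> p s + D \<le> r * D"
        unfolding V_def by (auto simp: abs_less_iff simp flip: of_nat_mult of_nat_add)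
      then have "\<not> p s \<le> r * D" using gap by blast
      then show "s \<in> U" using s r unfolding U_def by auto
    qed
    ultimately have "V = U" using finU \<open>card U = 2\<close> by (metis card_subset_eq)
    obtain a b where ab: "U = {a, b}" "a \<noteq> b"
      using \<open>card U = 2\<close> by (auto simp: card_2_iff)
    \<comment> \<open>Both \<open>a\<close> and \<open>b\<close> lie between the layers
      \<open>r * D\<close> and \<open>q * D + 1\<close>, which are \<open>D + 1\<close> apart, so
      each adds \<open>D + 1\<close> to the two sums together.\<close>
    have "\<bar>int (p a) - int (r * D)\<bar> + \<bar>int (p b) - int (r * D)\<bar> \<le> int D"
      using pair[OF rN none_r] \<open>V = U\<close> ab unfolding V_def by blast
    moreover have "\<bar>int (p a) - int (Suc (q * D))\<bar> + \<bar>int (p b) - int (Suc (q * D))\<bar> \<le> int D"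
      using pair[OF qN none] \<open>W = U\<close> ab unfolding W_def by blast
    ultimately show False using r by (simp add: algebra_simps abs_if split: if_splits)
  qed
qed

section \<open>Distances in the strong product with a path\<close>

context connected_pair_graph
begin

lemma gdist_strong_product_path:
  assumes "p < t" "w \<in> pverts G" "i < t" "b \<in> pverts G"
  shows "gdist (strong_product (path_graph t) G) (p, w) (i, b) = max (nat \<bar>int p - int i\<bar>) (d w b)"
proof -
  let ?X = "strong_product (path_graph t) G"
  interpret X: pair_graph ?X
    by (intro pair_graph_strong_product pair_graph_path_graph pair_graph)
  define f where "f = (\<lambda>(i, b). max (nat \<bar>int p - int i\<bar>) (d w b))"
  have "gdist ?X (p, w) (i, b) = f (i, b)"
  proof (rule X.gdist_eqI)
    show "(p, w) \<in> pverts ?X" "(i, b) \<in> pverts ?X" "f (p, w) = 0"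
      using assms by (auto simp: strong_product_def path_graph_def f_def)
  next
    fix x y assume xy: "(x, y) \<in> parcs ?X"
    obtain i b j c where eq: "x = (i, b)" "y = (j, c)" by fastforce
    have "i = j \<or> j = Suc i \<or> i = Suc j" "b = c \<or> (b, c) \<in> parcs G"
      using xy by (auto simp: eq strong_product_def path_graph_def)
    moreover from this(2) have "d w c \<le> Suc (d w b)"
      using gdist_arc_le assms(2) by auto
    ultimately show "f y \<le> Suc (f x)"
      by (auto simp: f_def eq)
  next
    fix x assume x: "x \<in> pverts ?X" "x \<noteq> (p, w)"
    obtain i b where eq: "x = (i, b)" by fastforce
    have ib: "i < t" "b \<in> pverts G" using x by (auto simp: eq strong_product_def path_graph_def)
    \<comment> \<open>The predecessor of \<open>(i, b)\<close> moves each coordinate towards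
      \<open>(p, w)\<close> unless it has arrived there; moving both at once is what lowers the
      maximum.\<close>
    define j where "j = (if i < p then Suc i else if p < i then i - 1 else i)"
    have j: "j = i \<and> i = p \<or> (j, i) \<in> parcs (path_graph t) \<and> nat \<bar>int p - int j\<bar> < nat \<bar>int p - int i\<bar>"
      using ib assms(1) by (auto simp: j_def path_graph_def)
    obtain c where c: "c = b \<and> b = w \<or> (c, b) \<in> parcs G \<and> d w c < d w b"
      using ex_neighbour[OF assms(2) ib(2)] by (metis lessI)
    have "((j, c), (i, b)) \<in> parcs ?X"
      using j c ib x(2) arc_endsD[of c b]
      by (auto simp: eq strong_product_def path_graph_def)
    moreover have "f (j, c) < f (i, b)"
      using j c x(2) ib assms(2) by (auto simp: f_def eq)
    ultimately show "\<exists>y. (y, x) \<in> parcs ?X \<and> f y < f x" unfolding eq by blast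
  qed
  then show ?thesis by (simp add: f_def)
qed

lemma ex_arc_from:
  assumes "card (pverts G) \<ge> 2" "w \<in> pverts G"
  obtains v where "(w, v) \<in> parcs G"
proof -
  have "\<not> pverts G \<subseteq> {w}"
    using assms(1) card_mono[of "{w}" "pverts G"] by auto
  then obtain u where "u \<in> pverts G" "u \<noteq> w" by blast
  then obtain v where "(v, w) \<in> parcs G" using ex_neighbour assms(2) by metis
  then show thesis using that arc_sym by blast
qed

lemma diameter_pos:
  assumes "card (pverts G) \<ge> 2"
  shows "diameter G > 0"
proof -
  obtain w where w: "w \<in> pverts G" using assms by fastforce
  obtain v where "(w, v) \<in> parcs G" using ex_arc_from[OF assms w] .
  then show ?thesis using gdist_arc[of w v] gdist_le_diameter[of w v] arc_endsD[of w v] by simp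
qed

lemma local_metric_generator_strong_product_path_iff:
  "local_metric_generator (strong_product (path_graph t) G) S \<longleftrightarrow>
     S \<subseteq> {..<t} \<times> pverts G \<and>
     (\<forall>((i, u), (j, v)) \<in> parcs (strong_product (path_graph t) G). \<exists>(p, w)\<in>S.
        max (nat \<bar>int p - int i\<bar>) (d w u) \<noteq> max (nat \<bar>int p - int j\<bar>) (d w v))"
proof -
  have V: "pverts (strong_product (path_graph t) G) = {..<t} \<times> pverts G"
    by (simp add: strong_product_def path_graph_def)
  have arcs: "parcs (strong_product (path_graph t) G) \<subseteq> ({..<t} \<times> pverts G) \<times> ({..<t} \<times> pverts G)"
    by (auto simp: strong_product_def path_graph_def)
  show ?thesis
    unfolding local_metric_generator_def V
  proof (intro conj_cong refl ball_cong, clarify)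
    fix i u j v
    assume S: "S \<subseteq> {..<t} \<times> pverts G"
      and "((i, u), (j, v)) \<in> parcs (strong_product (path_graph t) G)"
    then have "i < t" "j < t" "u \<in> pverts G" "v \<in> pverts G" using arcs by auto
    then show "(\<exists>s\<in>S. gdist (strong_product (path_graph t) G) s (i, u) \<noteq>
          gdist (strong_product (path_graph t) G) s (j, v)) \<longleftrightarrow>
        (\<exists>(p, w)\<in>S. max (nat \<bar>int p - int i\<bar>) (d w u) \<noteq> max (nat \<bar>int p - int j\<bar>) (d w v))"
      using S by (intro bex_cong refl) (auto simp: gdist_strong_product_path)
  qed
qed

section \<open>The lower bound\<close>

lemma local_metric_generator_card_ge:
  assumes gen: "local_metric_generator (strong_product (path_graph (Suc N)) G) S"
    and fin: "finite S" and V: "card (pverts G) \<ge> 2"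
  shows "N + diameter G \<le> card S * diameter G"
proof (rule path_layer_counting[where p = fst])
  have sub: "S \<subseteq> {..<Suc N} \<times> pverts G"
    using gen by (simp add: local_metric_generator_strong_product_path_iff)
  \<comment> \<open>Within one layer the path distance is the same for both ends of the arc and acts
    as a cutoff: it has to be below the larger of the two distances in \<open>G\<close>.\<close>
  have cover: "\<exists>s\<in>S. \<bar>int (fst s) - int i\<bar> < int (max (d (snd s) u) (d (snd s) v))"
    if "i \<le> N" "(u, v) \<in> parcs G" for i u v
  proof -
    have "((i, u), (i, v)) \<in> parcs (strong_product (path_graph (Suc N)) G)"
      using that arc_endsD[OF that(2)] by (auto simp: strong_product_def path_graph_def)
    then obtain p w where "(p, w) \<in> S"
      "max (nat \<bar>int p - int i\<bar>) (d w u) \<noteq> max (nat \<bar>int p - int i\<bar>) (d w v)"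
      using gen unfolding local_metric_generator_strong_product_path_iff by fastforce
    then show ?thesis by (intro bexI[of _ "(p, w)"]) auto
  qed
  define W where "W i = {s \<in> S. \<bar>int (fst s) - int i\<bar> < int (diameter G)}" for i
  have finW: "finite (W i)" for i using fin by (simp add: W_def)
  have coverW: "\<exists>s\<in>W i. \<bar>int (fst s) - int i\<bar> < int (max (d (snd s) u) (d (snd s) v))"
    if i: "i \<le> N" and uv: "(u, v) \<in> parcs G" for i u v
  proof -
    obtain s where s: "s \<in> S" "\<bar>int (fst s) - int i\<bar> < int (max (d (snd s) u) (d (snd s) v))"
      using cover[OF i uv] by blast
    moreover have "max (d (snd s) u) (d (snd s) v) \<le> diameter G"
      using gdist_le_diameter s(1) sub arc_endsD[OF uv] by auto
    ultimately show ?thesis unfolding W_def by (intro bexI[of _ s]) auto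
  qed
  show "finite S" "diameter G > 0" by (fact fin, fact diameter_pos[OF V])
  show "fst s \<le> N" if "s \<in> S" for s using that sub by auto
  \<comment> \<open>At an arc starting in \<open>w\<close> itself the distances are 0 and 1, so only
    an element on layer \<open>i\<close> could pass the cutoff. This includes the case that
    \<open>W i\<close> is empty.\<close>
  have twin: False if "i \<le> N" "\<forall>s\<in>S. fst s \<noteq> i" and w: "w \<in> pverts G" and W: "\<forall>s\<in>W i. snd s = w" for i w
  proof -
    obtain v where v: "(w, v) \<in> parcs G" using ex_arc_from[OF V w] .
    obtain s where s: "s \<in> W i" "\<bar>int (fst s) - int i\<bar> < int (max (d (snd s) w) (d (snd s) v))"
      using coverW[OF \<open>i \<le> N\<close> v] by blast
    then have "fst s = i" using w W gdist_arc[OF v] by simp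
    then show False using s(1) that(2) by (simp add: W_def)
  qed
  show "(\<exists>s\<in>S. fst s = i) \<or> card {s \<in> S. \<bar>int (fst s) - int i\<bar> < int (diameter G)} \<ge> 2"
    if i: "i \<le> N" for i
    unfolding W_def[symmetric]
  proof (rule ccontr)
    assume "\<not> ((\<exists>s\<in>S. fst s = i) \<or> card (W i) \<ge> 2)"
    then have no: "\<forall>s\<in>S. fst s \<noteq> i" and "card (W i) \<le> 1" by auto
    obtain w0 where w0: "w0 \<in> pverts G" using V by fastforce
    have "W i \<noteq> {}" using twin[OF i no w0] by blast
    then obtain s where s: "s \<in> W i" by blast
    then have "W i = {s}"
      using \<open>card (W i) \<le> 1\<close> finW[of i] card_seteq[of "W i" "{s}"] by simp
    then have same: "\<forall>s'\<in>W i. snd s' = snd s" by simp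
    have "snd s \<in> pverts G" using s sub by (auto simp: W_def)
    from twin[OF i no this same] show False .
  qed
  show "\<bar>int (fst a) - int i\<bar> + \<bar>int (fst b) - int i\<bar> \<le> int (diameter G)"
    if i: "i \<le> N" and no: "\<forall>s\<in>S. fst s \<noteq> i"
      and W: "{s \<in> S. \<bar>int (fst s) - int i\<bar> < int (diameter G)} = {a, b}" for i a b
  proof (rule ccontr)
    define e where "e = nat \<bar>int (fst a) - int i\<bar>"
    define e' where "e' = nat \<bar>int (fst b) - int i\<bar>"
    define l where "l = d (snd a) (snd b)"
    assume neg: "\<not> ?thesis"
    have Wi: "W i = {a, b}" using W by (simp add: W_def)
    then have ab: "a \<in> S" "b \<in> S" by (auto simp: W_def)
    then have vs: "snd a \<in> pverts G" "snd b \<in> pverts G" using sub by auto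
    have "fst a \<noteq> i" "fst b \<noteq> i" using no ab by auto
    then have e0: "e > 0" "e' > 0" by (auto simp: e_def e'_def)
    have "snd a \<noteq> snd b" using twin[OF i no vs(1)] Wi by auto
    then have l0: "l > 0" using vs by (metis gdist_eq_0_iff gr0I l_def)
    have "l < e + e'" using neg gdist_le_diameter[OF vs] unfolding l_def e_def e'_def by linarith
    \<comment> \<open>The arc from distance \<open>x\<close> to \<open>x + 1\<close> on a geodesic
      between the two coordinates: \<open>a\<close> misses it because \<open>x + 1 \<le> e\<close>,
      and \<open>b\<close> because \<open>l - x \<le> e'\<close>, which holds by
      \<open>l < e + e'\<close>.\<close>
    define x where "x = min e l - 1"
    have x: "x < l" "Suc x \<le> e" "l - x \<le> e'"
      using e0 l0 \<open>l < e + e'\<close> by (auto simp: x_def min_def)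
    obtain y z where yz: "(y, z) \<in> parcs G" "d (snd a) y = x" "d (snd a) z = Suc x"
      "d (snd b) y = l - x" "d (snd b) z = l - Suc x"
      using geodesic_arc[OF vs x(1)[unfolded l_def]] unfolding l_def by blast
    show False using coverW[OF i yz(1)] x unfolding Wi by (auto simp: yz e_def e'_def)
  qed
qed

section \<open>The upper bound\<close>

text \<open>
  Two adjacent vertices on one layer have distances to \<open>a\<close> differing by one, so the larger one
  exceeds half their sum; the four distances sum up to at least \<open>2 * d a b\<close>.
\<close>

lemma antipodal_pair_distinguishes:
  assumes "bipartite G" "(u, v) \<in> parcs G" "a \<in> pverts G" "b \<in> pverts G" "e + e' \<le> d a b"
  shows "max e (d a u) \<noteq> max e (d a v) \<or> max e' (d b u) \<noteq> max e' (d b v)"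
proof -
  note uv = arc_endsD[OF assms(2)]
  have "d a u \<noteq> d a v" "d b u \<noteq> d b v"
    using bipartite_gdist_neq assms by auto
  moreover have "d a b \<le> d a u + d b u" "d a b \<le> d a v + d b v"
    using gdist_triangle[of a u b] gdist_triangle[of a v b] gdist_commute assms(3,4) uv by auto
  ultimately show ?thesis using assms(5) by (auto simp: max_def split: if_splits)
qed

lemma ex_local_metric_generator:
  assumes V: "card (pverts G) \<ge> 2" and bip: "bipartite G"
    and N: "2 * diameter G \<le> N" "N \<le> k * diameter G"
  shows "\<exists>S. local_metric_generator (strong_product (path_graph (Suc N)) G) S \<and> finite S \<and> card S \<le> Suc k"
proof -
  let ?D = "diameter G" and ?X = "strong_product (path_graph (Suc N)) G"
  have D: "?D > 0" by (rule diameter_pos[OF V])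
  have "pverts G \<noteq> {}" using V by auto
  then obtain a b where ab: "a \<in> pverts G" "b \<in> pverts G" "d a b = ?D"
    using diameter_attained by blast
  define c where "c n = (if even n then a else b)" for n :: nat
  have c: "c n \<in> pverts G" for n using ab by (simp add: c_def)
  have cc: "d (c n) (c (Suc n)) = ?D" for n using ab gdist_commute by (simp add: c_def)
  \<comment> \<open>Capping at \<open>N\<close> keeps consecutive elements at most \<open>D\<close>
    layers apart and puts number \<open>k\<close> on the last layer, as
    \<open>N \<le> k * D\<close>.\<close>
  define S where "S = (\<lambda>n. (min (n * ?D) N, c n)) ` {..k}"
  have fin: "finite S" and card: "card S \<le> Suc k"
    using card_image_le[of "{..k}" "\<lambda>n. (min (n * ?D) N, c n)"] by (auto simp: S_def)
  have mem: "(min (n * ?D) N, c n) \<in> S" if "n \<le> k" for n using that by (auto simp: S_def)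
  have mem0: "(0, c 0) \<in> S" using mem[of 0] by simp
  have memN: "(N, c k) \<in> S" using mem[of k] N(2) by (simp add: min_absorb2)
  have same: "\<exists>(p, w)\<in>S. max (nat \<bar>int p - int i\<bar>) (d w u) \<noteq> max (nat \<bar>int p - int i\<bar>) (d w v)"
    if i: "i \<le> N" and uv: "(u, v) \<in> parcs G" for i u v
  proof -
    \<comment> \<open>Subtracting one keeps \<open>n < k\<close> even for \<open>i = k * D\<close>,
      while still \<open>n * D \<le> i \<le> (n + 1) * D\<close>; truncation handles
      \<open>i = 0\<close>.\<close>
    define n where "n = (i - 1) div ?D"
    have "k > 0" using N D by (cases k) auto
    then have "i - 1 < k * ?D" using i N D by (cases i) auto
    then have nk: "n < k" using D by (simp add: n_def less_mult_imp_div_less)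
    have n1: "n * ?D \<le> i" unfolding n_def
      by (rule order_trans[OF div_times_less_eq_dividend]) simp
    have "i - 1 < Suc n * ?D" using dividend_less_div_times[OF D] by (simp add: n_def add.commute)
    then have n2: "i \<le> Suc n * ?D" by linarith
    define e where "e = nat \<bar>int (min (n * ?D) N) - int i\<bar>"
    define e' where "e' = nat \<bar>int (min (Suc n * ?D) N) - int i\<bar>"
    have "e \<le> i - n * ?D" "e' \<le> Suc n * ?D - i"
      using n1 n2 i unfolding e_def e'_def by linarith+
    then have "e + e' \<le> d (c n) (c (Suc n))" using n1 n2 by (simp add: cc)
    from antipodal_pair_distinguishes[OF bip uv c c this]
    show ?thesis using mem[of n] mem[of "Suc n"] nk unfolding e_def e'_def by (auto simp del: mult_Suc)
  qed
  \<comment> \<open>If both layers are at least \<open>D\<close> away from layer 0, the distances to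
    the first element are the layer numbers. Otherwise both layers are at most \<open>D\<close>, so
    by \<open>2 * D \<le> N\<close> they are at least \<open>D\<close> away from the last layer, and
    the last element sees only the layer difference.\<close>
  have step: "\<exists>(p, w)\<in>S. max (nat \<bar>int p - int i\<bar>) (d w u) \<noteq> max (nat \<bar>int p - int j\<bar>) (d w v)"
    if ij: "j = Suc i \<or> i = Suc j" "i \<le> N" "j \<le> N" and uv: "u \<in> pverts G" "v \<in> pverts G" for i j u v
  proof (cases "?D \<le> min i j")
    case True
    then show ?thesis
      using ij gdist_le_diameter[OF c uv(1), of 0] gdist_le_diameter[OF c uv(2), of 0]
      by (intro bexI[OF _ mem0]) (auto simp: max_def)
  next
    case False
    then show ?thesis
      using ij N(1) gdist_le_diameter[OF c uv(1), of k] gdist_le_diameter[OF c uv(2), of k]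
      by (intro bexI[OF _ memN]) (auto simp: max_def)
  qed
  have sub: "S \<subseteq> {..<Suc N} \<times> pverts G" using c by (auto simp: S_def)
  have dist: "\<exists>(p, w)\<in>S. max (nat \<bar>int p - int i\<bar>) (d w u) \<noteq> max (nat \<bar>int p - int j\<bar>) (d w v)"
    if "((i, u), (j, v)) \<in> parcs ?X" for i u j v
  proof -
    have "i \<le> N" "j \<le> N" "u \<in> pverts G" "v \<in> pverts G"
      "i = j \<and> (u, v) \<in> parcs G \<or> j = Suc i \<or> i = Suc j"
      using that by (auto simp: strong_product_def path_graph_def)
    then show ?thesis using same step by blast
  qed
  have "local_metric_generator ?X S"
    unfolding local_metric_generator_strong_product_path_iff
  proof (intro conjI sub, clarify)
    fix i u j v assume "((i, u), (j, v)) \<in> parcs ?X"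
    then show "\<exists>(p, w)\<in>S. max (nat \<bar>int p - int i\<bar>) (d w u) \<noteq> max (nat \<bar>int p - int j\<bar>) (d w v)"
      by (rule dist)
  qed
  then show ?thesis using fin card by blast
qed

end

section \<open>The ceiling formula\<close>

theorem theorem18:
  fixes G :: "'a pair_pre_digraph" and t :: nat
  assumes "pair_graph G"
    and "Digraph_Component.connected (with_proj G)"
    and "card (pverts G) \<ge> 2"
    and "bipartite G"
    and "t \<ge> 2 * diameter G + 1"
  shows "int (local_metric_dim (strong_product (path_graph t) G))
           = \<lceil>(real t - 1) / real (diameter G)\<rceil> + 1"
proof -
  interpret connected_pair_graph G
    using assms(1,2) by (simp add: connected_pair_graph_def connected_pair_graph_axioms_def)
  let ?D = "diameter G"
  have D: "?D > 0" using diameter_pos[OF assms(3)] .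
  obtain N where t: "t = Suc N" and N: "2 * ?D \<le> N"
    using assms(5) by (cases t) auto
  define k where "k = nat \<lceil>real N / real ?D\<rceil>"
  have k: "int k = \<lceil>real N / real ?D\<rceil>" unfolding k_def
    by (rule nat_0_le) (metis ceiling_mono ceiling_zero divide_nonneg_nonneg of_nat_0_le_iff)
  have "real N / real ?D \<le> real k" using k by linarith
  then have "real N \<le> real (k * ?D)" using D by (simp add: field_simps)
  then have "N \<le> k * ?D" by linarith
  \<comment> \<open>The construction gives only \<open>card S \<le> Suc k\<close>; equality follows
    by applying \<open>lower\<close> to this very \<open>S\<close>.\<close>
  from ex_local_metric_generator[OF assms(3,4) N this] obtain S where
    S: "local_metric_generator (strong_product (path_graph t) G) S" "finite S" "card S \<le> Suc k"
    unfolding t by blast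
  have lower: "Suc k \<le> card S'"
    if "local_metric_generator (strong_product (path_graph t) G) S'" "finite S'" for S'
  proof -
    have "N + ?D \<le> card S' * ?D"
      using local_metric_generator_card_ge[OF that[unfolded t] assms(3)] .
    then have "real (N + ?D) \<le> real (card S' * ?D)" by (rule of_nat_mono)
    then have "real N / real ?D \<le> of_int (int (card S') - 1)"
      using D by (simp add: field_simps)
    then have "int k \<le> int (card S') - 1" unfolding k by (rule ceiling_le)
    then show ?thesis by simp
  qed
  have "local_metric_dim (strong_product (path_graph t) G) = Suc k"
    unfolding local_metric_dim_def
  proof (rule Least_equality)
    show "\<exists>S. local_metric_generator (strong_product (path_graph t) G) S \<and> finite S \<and> card S = Suc k"
      using S lower[OF S(1,2)] by (intro exI[of _ S]) auto
  qed (use lower in blast)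
  then show ?thesis using k by (simp add: t)
qed

end
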